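(* Let $\mathbb T_4^{\setminus(03)}$ be the digraph with vertex set $\{0,1,2,3\}$ and edge set $\{(0,1),(0,2),(1,2),(1,3),(2,3)\}$, and let $\mathbb{O}\mathrm{rd}=(\{0,1\};\leq,\{0\},\{1\})$. Then $\mathbb T_4^{\setminus(03)}\equiv\mathbb{O}\mathrm{rd}$.
   Context: A primitive positive (pp) formula is a first-order formula built from atomic formulas $R(x_1,\dots,x_n)$, $x\approx y$, and the always-false formula $\bot$ using only conjunction and existential quantification. A structure is a pp-power of $\mathbb A$ if it is isomorphic to a structure with domain $A^n$ for some $n\geq 1$ whose relations are pp-definable in $\mathbb A$ (a $k$-ary relation on $A^n$ being regarded as a $kn$-ary relation on $A$). $\mathbb A\leq\mathbb B$ ("$\mathbb A$ pp-constructs $\mathbb B$") means that $\mathbb B$ is homomorphically equivalent to a pp-power of $\mathbb A$. $\mathbb A\equiv\mathbb B$ means $\mathbb A\leq\mathbb B$ and $\mathbb B\leq\mathbb A$. In $\mathbb{O}\mathrm{rd}$ the relation $\leq$ is $\{(0,0),(0,1),(1,1)\}$ and $\{0\},\{1\}$ are unary relations. *)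

theory Defs
  imports Main
begin

text \<open>
  A relational structure whose relation symbols are the elements of the type \<open>'r\<close>. It carries its
  domain, the arity of each symbol, and the interpretation of each symbol as a set of tuples, where
  a \<open>k\<close>-tuple is a list of length \<open>k\<close>.
\<close>

record ('r, 'a) rel_struct =
  Dom :: "'a set"
  arity :: "'r \<Rightarrow> nat"
  Rel :: "'r \<Rightarrow> 'a list set"

definition tuples :: "nat \<Rightarrow> 'a set \<Rightarrow> 'a list set" where
  "tuples k A = {xs. length xs = k \<and> set xs \<subseteq> A}"

definition is_structure :: "('r, 'a) rel_struct \<Rightarrow> bool" where
  "is_structure A \<longleftrightarrow> Dom A \<noteq> {} \<and> (\<forall>r. Rel A r \<subseteq> tuples (arity A r) (Dom A))"

definition homomorphism ::
  "('r, 'a) rel_struct \<Rightarrow> ('r, 'b) rel_struct \<Rightarrow> ('a \<Rightarrow> 'b) \<Rightarrow> bool" where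
  "homomorphism A B h \<longleftrightarrow>
     arity A = arity B \<and> h ` Dom A \<subseteq> Dom B \<and> (\<forall>r. \<forall>xs \<in> Rel A r. map h xs \<in> Rel B r)"

definition hom_equivalent :: "('r, 'a) rel_struct \<Rightarrow> ('r, 'b) rel_struct \<Rightarrow> bool" where
  "hom_equivalent A B \<longleftrightarrow> (\<exists>h. homomorphism A B h) \<and> (\<exists>g. homomorphism B A g)"

definition isomorphic :: "('r, 'a) rel_struct \<Rightarrow> ('r, 'b) rel_struct \<Rightarrow> bool" where
  "isomorphic A B \<longleftrightarrow>
     (\<exists>h. arity A = arity B \<and> bij_betw h (Dom A) (Dom B) \<and>
        (\<forall>r. \<forall>xs \<in> tuples (arity A r) (Dom A). xs \<in> Rel A r \<longleftrightarrow> map h xs \<in> Rel B r))"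

datatype 'r pp_formula =
    Bot
  | Eq nat nat
  | Atom 'r "nat list"
  | Conj "'r pp_formula" "'r pp_formula"
  | Ex nat "'r pp_formula"

fun well_formed :: "('r \<Rightarrow> nat) \<Rightarrow> 'r pp_formula \<Rightarrow> bool" where
  "well_formed ar Bot \<longleftrightarrow> True"
| "well_formed ar (Eq x y) \<longleftrightarrow> True"
| "well_formed ar (Atom r xs) \<longleftrightarrow> length xs = ar r"
| "well_formed ar (Conj \<phi> \<psi>) \<longleftrightarrow> well_formed ar \<phi> \<and> well_formed ar \<psi>"
| "well_formed ar (Ex x \<phi>) \<longleftrightarrow> well_formed ar \<phi>"

fun free_vars :: "'r pp_formula \<Rightarrow> nat set" where
  "free_vars Bot = {}"
| "free_vars (Eq x y) = {x, y}"
| "free_vars (Atom r xs) = set xs"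
| "free_vars (Conj \<phi> \<psi>) = free_vars \<phi> \<union> free_vars \<psi>"
| "free_vars (Ex x \<phi>) = free_vars \<phi> - {x}"

fun sat :: "('r, 'a) rel_struct \<Rightarrow> (nat \<Rightarrow> 'a) \<Rightarrow> 'r pp_formula \<Rightarrow> bool" where
  "sat A e Bot \<longleftrightarrow> False"
| "sat A e (Eq x y) \<longleftrightarrow> e x = e y"
| "sat A e (Atom r xs) \<longleftrightarrow> map e xs \<in> Rel A r"
| "sat A e (Conj \<phi> \<psi>) \<longleftrightarrow> sat A e \<phi> \<and> sat A e \<psi>"
| "sat A e (Ex x \<phi>) \<longleftrightarrow> (\<exists>a \<in> Dom A. sat A (e(x := a)) \<phi>)"

text \<open>
  The free variables of a formula defining a \<open>k\<close>-ary relation are among \<open>0, \<dots>, k - 1\<close>, variable \<open>i\<close>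
  standing for the \<open>i\<close>-th coordinate. Outside this range the assignment \<open>nth xs\<close> is unspecified, but
  irrelevant to satisfaction.
\<close>

definition pp_definable :: "('r, 'a) rel_struct \<Rightarrow> nat \<Rightarrow> 'a list set \<Rightarrow> bool" where
  "pp_definable A k R \<longleftrightarrow>
     (\<exists>\<phi>. well_formed (arity A) \<phi> \<and> free_vars \<phi> \<subseteq> {..<k} \<and>
        R = {xs \<in> tuples k (Dom A). sat A (nth xs) \<phi>})"

text \<open>
  A \<open>k\<close>-ary relation on \<open>A\<^sup>n\<close> is a set of lists of length \<open>k\<close> whose entries are lists of length \<open>n\<close>;
  concatenating the entries turns it into a \<open>kn\<close>-ary relation on \<open>A\<close>.
\<close>

definition is_pp_power :: "('r, 'a) rel_struct \<Rightarrow> ('s, 'c) rel_struct \<Rightarrow> bool" where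
  "is_pp_power A C \<longleftrightarrow>
     is_structure C \<and>
     (\<exists>n \<ge> 1. \<exists>D :: ('s, 'a list) rel_struct.
        is_structure D \<and> Dom D = tuples n (Dom A) \<and>
        (\<forall>r. pp_definable A (arity D r * n) (concat ` Rel D r)) \<and>
        isomorphic D C)"

text \<open>
  The type of the elements of the pp-power \<open>C\<close> is fixed to \<open>'a list\<close> because types cannot be
  quantified over. As every pp-power of \<open>A\<close> is isomorphic to one of this type, and homomorphic
  equivalence is invariant under isomorphism, this is no restriction.
\<close>

definition pp_constructs :: "('r, 'a) rel_struct \<Rightarrow> ('s, 'b) rel_struct \<Rightarrow> bool" where
  "pp_constructs A B \<longleftrightarrow>
     (\<exists>C :: ('s, 'a list) rel_struct. is_pp_power A C \<and> hom_equivalent B C)"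

definition pp_equivalent :: "('r, 'a) rel_struct \<Rightarrow> ('s, 'b) rel_struct \<Rightarrow> bool" where
  "pp_equivalent A B \<longleftrightarrow> pp_constructs A B \<and> pp_constructs B A"

datatype digraph_symbol = Edge

definition digraph :: "'a set \<Rightarrow> ('a \<times> 'a) set \<Rightarrow> (digraph_symbol, 'a) rel_struct" where
  "digraph V E = \<lparr>Dom = V, arity = (\<lambda>_. 2), Rel = (\<lambda>_. {[x, y] | x y. (x, y) \<in> E})\<rparr>"

definition T4_minus_03 :: "(digraph_symbol, nat) rel_struct" where
  "T4_minus_03 = digraph {0, 1, 2, 3} {(0, 1), (0, 2), (1, 2), (1, 3), (2, 3)}"

datatype ord_symbol = Leq | Zero | One

definition Ord :: "(ord_symbol, nat) rel_struct" where
  "Ord =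
     \<lparr>Dom = {0, 1},
      arity = (\<lambda>r. case r of Leq \<Rightarrow> 2 | Zero \<Rightarrow> 1 | One \<Rightarrow> 1),
      Rel = (\<lambda>r. case r of Leq \<Rightarrow> {[0, 0], [0, 1], [1, 1]} | Zero \<Rightarrow> {[0]} | One \<Rightarrow> {[1]})\<rparr>"

end

theory Submission
  imports Defs
begin

text \<open>
  The digraph pp-constructs \<open>Ord\<close> in dimension one: \<open>y \<rightarrow> w \<leftarrow> z \<rightarrow> x\<close> relates \<open>y\<close> to \<open>x\<close>
  in a way that is the order on \<open>{1, 2}\<close> and that collapses monotonically under
  \<open>0, 1 \<mapsto> 0\<close> and \<open>2, 3 \<mapsto> 1\<close>.
  Conversely, encode a vertex \<open>v\<close> in unary by the bits \<open>(v \<ge> 1, v \<ge> 2, v \<ge> 3)\<close>. The edges form the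
  chain \<open>(0,1) < (0,2) < (1,2) < (1,3) < (2,3)\<close> in the product order, so that in the encoding they are
  the solutions of \<open>x\<^sub>1 \<le> y\<^sub>2 \<le> x\<^sub>0 \<le> y\<^sub>1\<close> together with \<open>x\<^sub>2 = 0\<close> and \<open>y\<^sub>0 = 1\<close>; the remaining triples of
  bits are isolated vertices.
\<close>

text \<open>Lists serve as the points of the power, so that the isomorphism required by
  \<open>is_pp_power\<close> can be the identity.\<close>

definition pp_power ::
  "('r, 'a) rel_struct \<Rightarrow> nat \<Rightarrow> ('s \<Rightarrow> nat) \<Rightarrow> ('s \<Rightarrow> 'r pp_formula) \<Rightarrow> ('s, 'a list) rel_struct"
  where
  "pp_power A n ar \<phi> =
     \<lparr>Dom = tuples n (Dom A), arity = ar,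
      Rel = (\<lambda>r. {xss \<in> tuples (ar r) (tuples n (Dom A)). sat A (nth (concat xss)) (\<phi> r)})\<rparr>"

lemma tuples_0: "tuples 0 A = {[]}"
  by (auto simp: tuples_def)

lemma tuples_Suc: "tuples (Suc k) A = (\<lambda>(x, xs). x # xs) ` (A \<times> tuples k A)"
  by (auto simp: tuples_def length_Suc_conv image_iff)

lemma tuples_add: "tuples (m + n) A = (\<lambda>(xs, ys). xs @ ys) ` (tuples m A \<times> tuples n A)"
  by (induction m) (force simp: tuples_0 tuples_Suc image_iff)+

text \<open>Flat tuples can be cut into blocks, so no solution of a defining formula over
  \<open>A\<close> is missed by the flattened relation of the power.\<close>

lemma concat_tuples: "concat ` tuples k (tuples n A) = tuples (k * n) A"
proof (induction k)
  case 0
  show ?case by (simp add: tuples_0)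
next
  case (Suc k)
  have "concat ` tuples (Suc k) (tuples n A)
      = (\<lambda>(xs, ys). xs @ ys) ` (tuples n A \<times> concat ` tuples k (tuples n A))"
    by (force simp: tuples_Suc image_iff)
  then show ?case by (simp add: Suc.IH tuples_add)
qed

lemma isomorphic_refl: "isomorphic A A"
  unfolding isomorphic_def by (rule exI[of _ id]) simp

lemma is_pp_power_pp_power:
  assumes "Dom A \<noteq> {}" and "n \<ge> 1"
    and "\<And>r. well_formed (arity A) (\<phi> r)" and "\<And>r. free_vars (\<phi> r) \<subseteq> {..<ar r * n}"
  shows "is_pp_power A (pp_power A n ar \<phi>)"
proof -
  let ?D = "pp_power A n ar \<phi>"
  obtain a where "a \<in> Dom A" using assms(1) by blast
  then have "replicate n a \<in> tuples n (Dom A)"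
    by (auto simp: tuples_def)
  then have "is_structure ?D"
    by (auto simp: is_structure_def pp_power_def)
  moreover have "pp_definable A (arity ?D r * n) (concat ` Rel ?D r)" for r
  proof -
    have "concat ` Rel ?D r = {xs \<in> tuples (ar r * n) (Dom A). sat A (nth xs) (\<phi> r)}"
      by (auto simp: pp_power_def concat_tuples[symmetric])
    then have "concat ` Rel ?D r = {xs \<in> tuples (arity ?D r * n) (Dom A). sat A (nth xs) (\<phi> r)}"
      by (simp add: pp_power_def)
    moreover have "free_vars (\<phi> r) \<subseteq> {..<arity ?D r * n}"
      using assms(4) by (simp add: pp_power_def)
    ultimately show ?thesis
      using assms(3) unfolding pp_definable_def by (intro exI[of _ "\<phi> r"] conjI)
  qed
  moreover have "Dom ?D = tuples n (Dom A)"
    by (simp add: pp_power_def)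
  ultimately show ?thesis
    using assms(2) isomorphic_refl unfolding is_pp_power_def by blast
qed

lemma pp_constructsI:
  assumes "Dom A \<noteq> {}" and "n \<ge> 1"
    and "\<And>r. well_formed (arity A) (\<phi> r)" and "\<And>r. free_vars (\<phi> r) \<subseteq> {..<arity B r * n}"
    and "homomorphism B (pp_power A n (arity B) \<phi>) h"
    and "homomorphism (pp_power A n (arity B) \<phi>) B g"
  shows "pp_constructs A B"
  unfolding pp_constructs_def hom_equivalent_def
  by (intro exI[of _ "pp_power A n (arity B) \<phi>"] conjI is_pp_power_pp_power assms
      exI[of _ h] exI[of _ g])

text \<open>In \<open>T4_minus_03\<close> the starts of paths of length two are 0 and 1, and their
  ends are 2 and 3.\<close>

fun Ord_formula :: "ord_symbol \<Rightarrow> digraph_symbol pp_formula" where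
  "Ord_formula Leq =
     Ex 2 (Ex 3 (Conj (Atom Edge [0, 2]) (Conj (Atom Edge [3, 2]) (Atom Edge [3, 1]))))"
| "Ord_formula Zero = Ex 1 (Ex 2 (Conj (Atom Edge [0, 1]) (Atom Edge [1, 2])))"
| "Ord_formula One = Ex 1 (Ex 2 (Conj (Atom Edge [2, 1]) (Atom Edge [1, 0])))"

lemma T4_constructs_Ord: "pp_constructs T4_minus_03 Ord"
proof (rule pp_constructsI[where n = 1 and \<phi> = Ord_formula
      and h = "\<lambda>i. [i + 1]" and g = "\<lambda>xs. if hd xs \<le> 1 then 0 else 1"])
  show "Dom T4_minus_03 \<noteq> {}"
    by (simp add: T4_minus_03_def digraph_def)
  show "well_formed (arity T4_minus_03) (Ord_formula r)" for r
    by (cases r) (auto simp: T4_minus_03_def digraph_def)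
  show "free_vars (Ord_formula r) \<subseteq> {..<arity Ord r * 1}" for r
    by (cases r) (auto simp: Ord_def)
  show "homomorphism Ord (pp_power T4_minus_03 1 (arity Ord) Ord_formula) (\<lambda>i. [i + 1])"
    unfolding homomorphism_def
  proof (intro conjI allI ballI)
    fix r xs assume "xs \<in> Rel Ord r"
    then show "map (\<lambda>i. [i + 1]) xs \<in> Rel (pp_power T4_minus_03 1 (arity Ord) Ord_formula) r"
      by (cases r) (auto simp: Ord_def pp_power_def tuples_def T4_minus_03_def digraph_def)
  qed (auto simp: Ord_def pp_power_def tuples_def T4_minus_03_def digraph_def)
  show "homomorphism (pp_power T4_minus_03 1 (arity Ord) Ord_formula) Ord
          (\<lambda>xs. if hd xs \<le> 1 then 0 else 1)"
    unfolding homomorphism_def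
  proof (intro conjI allI ballI)
    fix r xss assume "xss \<in> Rel (pp_power T4_minus_03 1 (arity Ord) Ord_formula) r"
    \<comment> \<open>For \<open>Leq\<close>: the only edge from 2 goes to 3, whose in-neighbours 1
      and 2 have edges only into {2, 3}; 3 has no out-edge.\<close>
    then show "map (\<lambda>xs. if hd xs \<le> 1 then 0 else 1) xss \<in> Rel Ord r"
      by (cases r) (auto simp: Ord_def pp_power_def tuples_Suc tuples_0 numeral_2_eq_2
          T4_minus_03_def digraph_def)
  qed (auto simp: Ord_def pp_power_def)
qed simp

text \<open>Variables 0, 1, 2 are the bits of the tail and 3, 4, 5 those of the head. Vertex 3 is
  never a tail and 0 never a head, which fixes variables 2 and 3.\<close>

definition Edge_formula :: "ord_symbol pp_formula" where
  "Edge_formula =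
     Conj (Atom Zero [2]) (Conj (Atom One [3])
       (Conj (Atom Leq [1, 5]) (Conj (Atom Leq [5, 0]) (Atom Leq [0, 4]))))"

definition unary :: "nat \<Rightarrow> nat list" where
  "unary v = map (\<lambda>i. if i < v then 1 else 0) [0, 1, 2]"

lemma Ord_constructs_T4: "pp_constructs Ord T4_minus_03"
\<comment> \<open>\<open>sum_list\<close> decodes unary codes; the isolated triples only need some
  value in {0, 1, 2, 3}.\<close>
proof (rule pp_constructsI[where n = 3 and \<phi> = "\<lambda>_. Edge_formula" and h = unary and g = sum_list])
  show "Dom Ord \<noteq> {}"
    by (simp add: Ord_def)
  show "well_formed (arity Ord) Edge_formula"
    by (simp add: Edge_formula_def Ord_def)
  show "free_vars Edge_formula \<subseteq> {..<arity T4_minus_03 r * 3}" for r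
    by (auto simp: Edge_formula_def T4_minus_03_def digraph_def)
  show "homomorphism T4_minus_03 (pp_power Ord 3 (arity T4_minus_03) (\<lambda>_. Edge_formula)) unary"
    by (auto simp: homomorphism_def T4_minus_03_def digraph_def pp_power_def tuples_def Ord_def
        unary_def Edge_formula_def)
  show "homomorphism (pp_power Ord 3 (arity T4_minus_03) (\<lambda>_. Edge_formula)) T4_minus_03 sum_list"
    unfolding homomorphism_def
  proof (intro conjI allI ballI)
    fix r xss
    assume xss: "xss \<in> Rel (pp_power Ord 3 (arity T4_minus_03) (\<lambda>_. Edge_formula)) r"
    then have "xss \<in> tuples 2 (tuples 3 (Dom Ord))"
      by (simp add: pp_power_def T4_minus_03_def digraph_def)
    then obtain x0 x1 x2 y0 y1 y2 where xss_eq: "xss = [[x0, x1, x2], [y0, y1, y2]]"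
      by (auto simp: numeral_2_eq_2 numeral_3_eq_3 tuples_Suc tuples_0)
    have "x2 = 0" "y0 = 1" "x1 \<le> y2" "y2 \<le> x0" "x0 \<le> y1" "y1 \<le> 1"
      using xss by (auto simp: xss_eq pp_power_def Edge_formula_def Ord_def)
    \<comment> \<open>Capped by \<open>y1 \<le> 1\<close>, the chain of four bits has five
      solutions, one for each edge.\<close>
    then have "(x0 + x1 + x2, y0 + y1 + y2) \<in> {(0, 1), (0, 2), (1, 2), (1, 3), (2, 3)}"
      by (cases x1; cases y2; cases x0; cases y1) auto
    then show "map sum_list xss \<in> Rel T4_minus_03 r"
      by (auto simp: xss_eq T4_minus_03_def digraph_def add.assoc)
  next
    show "sum_list ` Dom (pp_power Ord 3 (arity T4_minus_03) (\<lambda>_. Edge_formula)) \<subseteq> Dom T4_minus_03"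
      by (auto simp: pp_power_def tuples_Suc tuples_0 numeral_3_eq_3 Ord_def
          T4_minus_03_def digraph_def)
  qed (simp add: pp_power_def)
qed simp

theorem lemma5p9: "pp_equivalent T4_minus_03 Ord"
  using T4_constructs_Ord Ord_constructs_T4 by (simp add: pp_equivalent_def)

end
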